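(* Let $k$ be a finite field, $r\in k$, $x \in F_k$ and $\beta \in k$. (i) If $\alpha \in k$ and $\alpha \ne r$, then $\alpha\beta x \sim_r \gamma x$, where \[ \gamma = \frac{r^2 - (\alpha - \beta)r + 1 - \alpha \beta}{r-\alpha}\in k. \] (ii) $r\beta x \in \mathcal{A}_r$ if and only if $x \in \mathcal{A}_0$.
   Context: $F_k$ is the free monoid of all finite words with letters in $k$ (identity: the empty word $\varepsilon$); $\alpha\beta x$, $r\beta x$ and $\gamma x$ denote concatenations of letters with the word $x$ (not products in $k$). $\pi : F_k \to \mathrm{SL}_2(k)$ is the monoid homomorphism with $\pi(\alpha) = \begin{bmatrix} 0 & 1 \\ -1 & \alpha \end{bmatrix}$ for each letter $\alpha \in k$, so $\pi(\alpha_1\cdots\alpha_l)=\pi(\alpha_1)\cdots\pi(\alpha_l)$ and $\pi(\varepsilon)$ is the identity matrix. Let $\mathbb{P}^1(k)$ be the set of equivalence classes of $k^2\smallsetminus\{0\}$ (column vectors) under scaling by elements of $k^\times$; $\mathrm{SL}_2(k)$ acts on it by left multiplication. For $r\in k$, $\mathcal{A}_r = \left\{w \in F_k : \pi(w)\begin{bmatrix} 0 \\ 1 \end{bmatrix} = \begin{bmatrix} 1 \\ r \end{bmatrix} \text{ in } \mathbb{P}^1(k)\right\}$ and $\mathcal{C}_r = F_k\smallsetminus\mathcal{A}_r$. The relation $\sim_r$ is the equivalence relation on $F_k$ induced by the partition $F_k=\mathcal{A}_r\sqcup\mathcal{C}_r$: $w\sim_r w'$ if and only if $w,w'$ are both in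 $\mathcal{A}_r$ or both in $\mathcal{C}_r$. *)

theory Defs
  imports "HOL-Analysis.Analysis"
begin

definition SL2 :: "('k::field ^ 2 ^ 2) set" where
  "SL2 = {M. det M = 1}"

definition proj_rel :: "(('k::field ^ 2) \<times> ('k ^ 2)) set" where
  "proj_rel = {(v, w). v \<noteq> 0 \<and> w \<noteq> 0 \<and> (\<exists>c. c \<noteq> 0 \<and> w = c *s v)}"

definition P1 :: "('k::field ^ 2) set set" where
  "P1 = (UNIV - {0}) // proj_rel"

definition proj_class :: "'k::field ^ 2 \<Rightarrow> ('k ^ 2) set" where
  "proj_class v = proj_rel `` {v}"

text \<open>A point of the projective line is a set of vectors, so a matrix acts on it by taking
  images; for invertible matrices this is the usual action (see \<open>proj_act_class\<close>).\<close>

definition proj_act :: "'k::field ^ 2 ^ 2 \<Rightarrow> ('k ^ 2) set \<Rightarrow> ('k ^ 2) set" where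
  "proj_act M X = (\<lambda>v. M *v v) ` X"

definition letter_matrix :: "'k::field \<Rightarrow> 'k ^ 2 ^ 2" where
  "letter_matrix a = vector [vector [0, 1], vector [-1, a]]"

text \<open>The free monoid on the set of elements of a field is the type of lists over it, with
  \<open>@\<close> as product.\<close>

primrec word_matrix :: "'k::field list \<Rightarrow> 'k ^ 2 ^ 2" where
  "word_matrix [] = mat 1"
| "word_matrix (a # w) = letter_matrix a ** word_matrix w"

definition acc_words :: "'k::field \<Rightarrow> 'k list set" where
  "acc_words r =
     {w. proj_act (word_matrix w) (proj_class (vector [0, 1])) = proj_class (vector [1, r])}"

definition rej_words :: "'k::field \<Rightarrow> 'k list set" where
  "rej_words r = UNIV - acc_words r"

definition word_equiv :: "'k::field \<Rightarrow> 'k list \<Rightarrow> 'k list \<Rightarrow> bool" where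
  "word_equiv r w w' \<longleftrightarrow>
     (w \<in> acc_words r \<and> w' \<in> acc_words r) \<or> (w \<in> rej_words r \<and> w' \<in> rej_words r)"

lemma word_matrix_singleton: "word_matrix [a] = letter_matrix a"
  by simp

lemma word_matrix_append: "word_matrix (u @ w) = word_matrix u ** word_matrix w"
  by (induction u) (simp_all add: matrix_mul_assoc)

lemma word_matrix_in_SL2: "word_matrix w \<in> SL2"
proof (induction w)
  case Nil
  then show ?case by (simp add: SL2_def)
next
  case (Cons a w)
  then show ?case
    by (simp add: SL2_def det_mul) (simp add: det_2 letter_matrix_def)
qed

lemma equiv_proj_rel: "equiv (UNIV - {0}) (proj_rel :: (('k::field ^ 2) \<times> ('k ^ 2)) set)"
proof (rule equivI)
  show "proj_rel \<subseteq> (UNIV - {0}) \<times> (UNIV - {0 :: 'k ^ 2})"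
    by (auto simp: proj_rel_def)
  show "refl_on (UNIV - {0}) (proj_rel :: (('k ^ 2) \<times> ('k ^ 2)) set)"
    by (auto simp: refl_on_def proj_rel_def intro!: exI[of _ 1])
  show "sym (proj_rel :: (('k ^ 2) \<times> ('k ^ 2)) set)"
  proof (rule symI)
    fix v w :: "'k ^ 2"
    assume "(v, w) \<in> proj_rel"
    then obtain c where "v \<noteq> 0" "w \<noteq> 0" "c \<noteq> 0" "w = c *s v"
      by (auto simp: proj_rel_def)
    then show "(w, v) \<in> proj_rel"
      by (auto simp: proj_rel_def vector_smult_assoc intro!: exI[of _ "inverse c"])
  qed
  show "trans (proj_rel :: (('k ^ 2) \<times> ('k ^ 2)) set)"
  proof (rule transI)
    fix u v w :: "'k ^ 2"
    assume "(u, v) \<in> proj_rel" "(v, w) \<in> proj_rel"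
    then obtain c d where "u \<noteq> 0" "w \<noteq> 0" "c \<noteq> 0" "d \<noteq> 0" "v = c *s u" "w = d *s v"
      by (auto simp: proj_rel_def)
    then show "(u, w) \<in> proj_rel"
      by (auto simp: proj_rel_def vector_smult_assoc intro!: exI[of _ "d * c"])
  qed
qed

lemma proj_class_in_P1: "v \<noteq> 0 \<Longrightarrow> proj_class v \<in> P1"
  by (simp add: P1_def proj_class_def quotientI)

lemma SL2_mult_nonzero:
  assumes "M \<in> SL2" "v \<noteq> 0"
  shows "M *v v \<noteq> 0"
proof
  assume "M *v v = 0"
  moreover have "\<exists>B. B ** M = mat 1"
    using assms(1) by (auto simp: SL2_def invertible_det_nz[symmetric] intro!: invertible_left_inverse[THEN iffD1] simp: invertible_det_nz)
  ultimately show False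
    using assms(2) by (metis matrix_left_invertible_ker)
qed

lemma proj_act_class:
  assumes "M \<in> SL2" "v \<noteq> 0"
  shows "proj_act M (proj_class v) = proj_class (M *v v)"
proof -
  have nz: "M *v v \<noteq> 0"
    using assms by (rule SL2_mult_nonzero)
  have cl: "proj_class u = {c *s u | c. c \<noteq> 0}" if "u \<noteq> 0" for u :: "'a ^ 2"
    using that by (auto simp: proj_class_def proj_rel_def)
  show ?thesis
    by (auto simp: proj_act_def cl[OF nz] cl[OF assms(2)] vector_scalar_commute image_iff) 
       (metis vector_scalar_commute)
qed

end

theory Submission
  imports Defs
begin

text \<open>Membership in \<open>acc_words r\<close> is the linear equation \<open>q = r p\<close> for \<open>(p, q) = \<pi>(w) (0, 1)\<close>,
  and prepending a letter \<open>a\<close> replaces \<open>(p, q)\<close> by \<open>(q, a q - p)\<close>. Hence \<open>\<alpha>\<beta>x\<close> is accepted iff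
  \<open>(r - \<alpha>) p = ((r - \<alpha>) \<beta> + 1) q\<close>, with \<open>(p, q)\<close> taken from \<open>x\<close>, and \<open>\<gamma>x\<close> iff \<open>p = (\<gamma> - r) q\<close>.
  The value of \<open>\<gamma>\<close> makes these agree when \<open>\<alpha> \<noteq> r\<close>; when \<open>\<alpha> = r\<close> the former reads \<open>q = 0\<close>.\<close>

text \<open>A concrete representative of the projective point that decides acceptance, so that the
  argument can run in coordinates.\<close>

definition word_vector :: "'k::field list \<Rightarrow> 'k ^ 2" where
  "word_vector w = word_matrix w *v vector [0, 1]"

lemma word_vector_nonzero: "word_vector w \<noteq> 0"
  unfolding word_vector_def
  by (rule SL2_mult_nonzero[OF word_matrix_in_SL2]) (simp add: vec_eq_iff forall_2)

lemma word_vector_Cons: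
  "word_vector (a # w) $ 1 = word_vector w $ 2"
  "word_vector (a # w) $ 2 = a * word_vector w $ 2 - word_vector w $ 1"
proof -
  have "word_vector (a # w) = letter_matrix a *v word_vector w"
    by (simp add: word_vector_def matrix_vector_mul_assoc)
  then show "word_vector (a # w) $ 1 = word_vector w $ 2"
    "word_vector (a # w) $ 2 = a * word_vector w $ 2 - word_vector w $ 1"
    by (simp_all add: letter_matrix_def matrix_vector_mult_def sum_2)
qed

lemma proj_class_eq_affine_iff:
  fixes v :: "'k::field ^ 2"
  assumes "v \<noteq> 0"
  shows "proj_class v = proj_class (vector [1, r]) \<longleftrightarrow> v $ 2 = r * v $ 1"
proof -
  have nz: "(vector [1, r] :: 'k ^ 2) \<noteq> 0"
    by (simp add: vec_eq_iff forall_2)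
  have "proj_class v = proj_class (vector [1, r]) \<longleftrightarrow> (vector [1, r], v) \<in> proj_rel"
    unfolding proj_class_def
    using eq_equiv_class_iff[OF equiv_proj_rel, of "vector [1, r]" v] nz assms by auto
  also have "\<dots> \<longleftrightarrow> (\<exists>c. c \<noteq> 0 \<and> v = c *s vector [1, r])"
    using nz assms by (simp add: proj_rel_def)
  \<comment> \<open>The scalar can only be \<open>v $ 1\<close>; it is nonzero, since otherwise the
    equation would force \<open>v = 0\<close>.\<close>
  also have "\<dots> \<longleftrightarrow> v $ 2 = r * v $ 1"
    using assms by (auto simp: vec_eq_iff forall_2 mult.commute)
  finally show ?thesis .
qed

lemma acc_words_iff: "w \<in> acc_words r \<longleftrightarrow> word_vector w $ 2 = r * word_vector w $ 1"
proof -
  have "(vector [0, 1] :: 'a ^ 2) \<noteq> 0"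
    by (simp add: vec_eq_iff forall_2)
  then have "proj_act (word_matrix w) (proj_class (vector [0, 1])) = proj_class (word_vector w)"
    by (simp add: proj_act_class word_matrix_in_SL2 word_vector_def)
  then show ?thesis
    by (simp add: acc_words_def proj_class_eq_affine_iff word_vector_nonzero)
qed

lemma word_equiv_iff: "word_equiv r w w' \<longleftrightarrow> (w \<in> acc_words r \<longleftrightarrow> w' \<in> acc_words r)"
  by (auto simp: word_equiv_def rej_words_def)

theorem theorem3p1:
  fixes r \<beta> :: "'k::{field, finite}" and x :: "'k list"
  shows "(\<forall>\<alpha>. \<alpha> \<noteq> r \<longrightarrow>
            word_equiv r (\<alpha> # \<beta> # x)
              (((r^2 - (\<alpha> - \<beta>) * r + 1 - \<alpha> * \<beta>) / (r - \<alpha>)) # x))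
         \<and> (r # \<beta> # x \<in> acc_words r \<longleftrightarrow> x \<in> acc_words 0)"
proof (intro conjI allI impI)
  let ?p = "word_vector x $ 1" and ?q = "word_vector x $ 2"
  \<comment> \<open>Kept free of division, so that it also covers \<alpha> = r and serves both
    parts.\<close>
  have two: "\<alpha> # \<beta> # x \<in> acc_words r \<longleftrightarrow> (r - \<alpha>) * ?p = ((r - \<alpha>) * \<beta> + 1) * ?q" for \<alpha>
    unfolding acc_words_iff word_vector_Cons by (auto simp: algebra_simps)
  show "r # \<beta> # x \<in> acc_words r \<longleftrightarrow> x \<in> acc_words 0"
    unfolding two by (simp add: acc_words_iff)
  fix \<alpha> assume "\<alpha> \<noteq> r"
  define \<gamma> where "\<gamma> = (r^2 - (\<alpha> - \<beta>) * r + 1 - \<alpha> * \<beta>) / (r - \<alpha>)"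
  have nz: "r - \<alpha> \<noteq> 0"
    using \<open>\<alpha> \<noteq> r\<close> by simp
  \<comment> \<open>This says \<gamma> = r + \<beta> + 1 / (r - \<alpha>), with the denominator
    cleared to match the coefficient of \<open>?q\<close> in \<open>two\<close>.\<close>
  have \<gamma>: "(r - \<alpha>) * (\<gamma> - r) = (r - \<alpha>) * \<beta> + 1"
  proof -
    have "(r - \<alpha>) * \<gamma> = r^2 - (\<alpha> - \<beta>) * r + 1 - \<alpha> * \<beta>"
      unfolding \<gamma>_def using nz by (simp only: times_divide_eq_right nonzero_mult_div_cancel_left not_False_eq_True)
    then show ?thesis
      unfolding right_diff_distrib by (simp add: algebra_simps power2_eq_square)
  qed
  have "\<gamma> # x \<in> acc_words r \<longleftrightarrow> ?p = (\<gamma> - r) * ?q"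
    unfolding acc_words_iff word_vector_Cons by (auto simp: algebra_simps)
  also have "\<dots> \<longleftrightarrow> (r - \<alpha>) * ?p = (r - \<alpha>) * ((\<gamma> - r) * ?q)"
    using nz by simp
  also have "\<dots> \<longleftrightarrow> \<alpha> # \<beta> # x \<in> acc_words r"
    unfolding two \<gamma>[symmetric] by (simp only: mult.assoc)
  finally show "word_equiv r (\<alpha> # \<beta> # x)
      (((r^2 - (\<alpha> - \<beta>) * r + 1 - \<alpha> * \<beta>) / (r - \<alpha>)) # x)"
    unfolding word_equiv_iff \<gamma>_def by blast
qed

end
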